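(* Let $f\in C^{1,1}(\mathbb{R})$ with $L_f:=\|f'\|_\infty<\infty$ and let $L'_f$ be the Lipschitz constant of $f'$. Let $L>L_f$, set $D:=\frac{2LL_f}{L^2-L_f^2}$, and let $\delta>0$ satisfy $$\delta\,L'_f\,(1+D^2)^{3/2}<L\qquad\text{and}\qquad \delta\,L^2L'_f<(L^2-L_f^2)^{3/2}.$$ Define $u:\mathbb{R}\to\mathbb{R}$ by $$u(x):=\sup_{y\in\mathbb{R}}\left[f(y)-L\sqrt{\delta^2+(x-y)^2}\right].$$ If $f$ is not twice differentiable at a point $y_0\in\mathbb{R}$, then $u$ is not twice differentiable at the point $x_0:=x(y_0)$, where $y\mapsto x(y)$ is the inverse of the bijection $x\mapsto y(x)$ described in the context.
   Context: $C^{1,1}(\mathbb{R})$ denotes the differentiable functions $f:\mathbb{R}\to\mathbb{R}$ whose derivative $f'$ is bounded and globally Lipschitz. Under the stated conditions on $\delta$, for every $x\in\mathbb{R}$ the supremum defining $u(x)$ is attained at a unique point $y(x)$, and $x\mapsto y(x)$ is a bijective Lipschitz map $\mathbb{R}\to\mathbb{R}$. Its inverse is denoted $x(y)$ and is given explicitly by $$x(y)=y-\frac{\delta f'(y)}{\sqrt{L^2-(f'(y))^2}}.$$ A function of one real variable is twice differentiable at a point if it is differentiable in a neighbourhood of that point and its derivative is differentiable at that point. *)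

theory Defs
  imports "HOL-Analysis.Analysis"
begin

definition C11 :: "(real \<Rightarrow> real) \<Rightarrow> bool" where
  "C11 f \<longleftrightarrow> (\<forall>x. f differentiable (at x)) \<and> bounded (range (deriv f)) \<and>
     (\<exists>C. C-lipschitz_on UNIV (deriv f))"

definition sup_norm :: "(real \<Rightarrow> real) \<Rightarrow> real" where
  "sup_norm g = (SUP x. \<bar>g x\<bar>)"

definition lipschitz_constant :: "(real \<Rightarrow> real) \<Rightarrow> real" where
  "lipschitz_constant g = Inf {C. C-lipschitz_on UNIV g}"

definition twice_differentiable_at :: "(real \<Rightarrow> real) \<Rightarrow> real \<Rightarrow> bool" where
  "twice_differentiable_at g x \<longleftrightarrow>
     (\<forall>\<^sub>F z in nhds x. g differentiable (at z)) \<and> deriv g differentiable (at x)"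

definition penalized :: "(real \<Rightarrow> real) \<Rightarrow> real \<Rightarrow> real \<Rightarrow> real \<Rightarrow> real \<Rightarrow> real" where
  "penalized f L \<delta> x y = f y - L * sqrt (\<delta>\<^sup>2 + (x - y)\<^sup>2)"

definition upper_envelope :: "(real \<Rightarrow> real) \<Rightarrow> real \<Rightarrow> real \<Rightarrow> real \<Rightarrow> real" where
  "upper_envelope f L \<delta> x = (SUP y. penalized f L \<delta> x y)"

text \<open>The following is meaningful only if the supremum is attained at exactly one point.\<close>

definition maximizer :: "(real \<Rightarrow> real) \<Rightarrow> real \<Rightarrow> real \<Rightarrow> real \<Rightarrow> real" where
  "maximizer f L \<delta> x = (THE y. penalized f L \<delta> x y = upper_envelope f L \<delta> x)"

end

theory Submission
  imports Defs
begin

text \<open>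
  Write \<open>h s = L * sqrt (\<delta>\<^sup>2 + s\<^sup>2)\<close> for the penalty, so that \<open>u x = (SUP y. f y - h (x - y))\<close>.
  The derivative \<open>h'\<close> is an increasing bijection from the line onto \<open>(-L, L)\<close> with an explicit
  inverse \<open>G\<close>, and \<open>f'\<close> takes its values in a compact part of that interval. Hence
  \<open>y \<mapsto> f y - h (x - y)\<close> has positive derivative at \<open>y\<close> exactly if \<open>y - G (f' y) < x\<close>. The map
  \<open>foot y = y - G (f' y)\<close> is the explicit map \<open>x(y)\<close>. The bound
  \<open>\<delta> * L\<^sup>2 * Lf' < (L\<^sup>2 - Lf\<^sup>2) powr (3/2)\<close> makes \<open>G \<circ> f'\<close> a contraction (\<open>shift_lipschitz\<close>,
  \<open>contraction_factor_bounds\<close>), so \<open>foot\<close> is an increasing bi-Lipschitz bijection. For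
  \<open>x = foot y\<close> the penalized function therefore increases before \<open>y\<close> and decreases after it, so
  the supremum is attained at \<open>y\<close> and nowhere else (\<open>penalized_less_at_foot\<close>), and \<open>foot\<close> is the
  inverse of the maximizer map.

  Suppose that \<open>u\<close> is twice differentiable at \<open>foot y0\<close>. Because \<open>u\<close> lies above each function
  \<open>x \<mapsto> f y - h (x - y)\<close> and touches it at \<open>foot y\<close>, differentiability of \<open>u\<close> there forces
  \<open>u' (foot y) = f' y\<close> (\<open>upper_envelope_derivative\<close>). The maximizer is thus \<open>x + G (u' x)\<close> near
  \<open>foot y0\<close>, so it is differentiable at that point, and its derivative is nonzero because \<open>foot\<close>
  is Lipschitz. Its inverse \<open>foot\<close> is then differentiable at \<open>y0\<close>, and so is
  \<open>f' y = h' (y - foot y)\<close>.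
\<close>

section \<open>The slope of the penalty and its inverse\<close>

definition penalty_slope :: "real \<Rightarrow> real \<Rightarrow> real \<Rightarrow> real" where
  "penalty_slope L \<delta> s = L * s / sqrt (\<delta>\<^sup>2 + s\<^sup>2)"

definition penalty_slope_inv :: "real \<Rightarrow> real \<Rightarrow> real \<Rightarrow> real" where
  "penalty_slope_inv L \<delta> t = \<delta> * t / sqrt (L\<^sup>2 - t\<^sup>2)"

lemma penalty_has_derivative:
  assumes "\<delta> > 0"
  shows "((\<lambda>s. L * sqrt (\<delta>\<^sup>2 + s\<^sup>2)) has_real_derivative penalty_slope L \<delta> s) (at s)"
proof -
  have "\<delta>\<^sup>2 + s\<^sup>2 > 0" using assms by (simp add: add_pos_nonneg)
  then show ?thesis
    unfolding penalty_slope_def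
    by (auto intro!: derivative_eq_intros simp: field_simps)
qed

lemma penalty_slope_has_derivative:
  assumes "\<delta> > 0"
  shows "(penalty_slope L \<delta> has_real_derivative L * \<delta>\<^sup>2 / sqrt (\<delta>\<^sup>2 + s\<^sup>2) ^ 3) (at s)"
proof -
  define r where "r = sqrt (\<delta>\<^sup>2 + s\<^sup>2)"
  have pos: "\<delta>\<^sup>2 + s\<^sup>2 > 0" using assms by (simp add: add_pos_nonneg)
  then have r: "r > 0" "r\<^sup>2 = \<delta>\<^sup>2 + s\<^sup>2" by (auto simp: r_def)
  have "((\<lambda>s. L * s / sqrt (\<delta>\<^sup>2 + s\<^sup>2)) has_real_derivative
      (L * r - L * s * (s / r)) / (r * r)) (at s)"
    using pos by (auto intro!: derivative_eq_intros simp: r_def field_simps)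
  also have "(L * r - L * s * (s / r)) / (r * r) = L * (r\<^sup>2 - s\<^sup>2) / r ^ 3"
    using r(1) by (simp add: field_simps power2_eq_square power3_eq_cube)
  also have "r\<^sup>2 - s\<^sup>2 = \<delta>\<^sup>2" using r(2) by simp
  finally show ?thesis by (simp add: r_def penalty_slope_def[abs_def])
qed

lemma penalty_slope_strict_mono:
  assumes "\<delta> > 0" "L > 0"
  shows "strict_mono (penalty_slope L \<delta>)"
proof (rule strict_monoI)
  fix a b :: real
  assume "a < b"
  have "L * \<delta>\<^sup>2 / sqrt (\<delta>\<^sup>2 + s\<^sup>2) ^ 3 > 0" for s
    using assms by (simp add: add_pos_nonneg)
  then show "penalty_slope L \<delta> a < penalty_slope L \<delta> b"
    using \<open>a < b\<close> penalty_slope_has_derivative[OF assms(1)]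
    by (blast intro: DERIV_pos_imp_increasing)
qed

lemma penalty_slope_penalty_slope_inv:
  assumes "\<delta> > 0" "\<bar>t\<bar> < L"
  shows "penalty_slope L \<delta> (penalty_slope_inv L \<delta> t) = t"
proof -
  define w where "w = sqrt (L\<^sup>2 - t\<^sup>2)"
  have "t\<^sup>2 < L\<^sup>2" using assms(2) by (simp add: abs_square_less_1 power2_strict_mono abs_less_iff)
  then have w: "w > 0" "w\<^sup>2 = L\<^sup>2 - t\<^sup>2" by (auto simp: w_def)
  have L: "L > 0" using assms(2) by linarith
  have "\<delta>\<^sup>2 + (\<delta> * t / w)\<^sup>2 = \<delta>\<^sup>2 * (w\<^sup>2 + t\<^sup>2) / w\<^sup>2"
    using w(1) by (simp add: field_simps power2_eq_square)
  also have "\<dots> = (\<delta> * L / w)\<^sup>2"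
    by (simp add: w(2) power_divide power_mult_distrib)
  finally have "sqrt (\<delta>\<^sup>2 + (\<delta> * t / w)\<^sup>2) = \<delta> * L / w"
    using assms(1) w(1) L by (simp add: real_sqrt_abs)
  then show ?thesis
    using assms(1) w(1) L by (simp add: penalty_slope_def penalty_slope_inv_def w_def[symmetric])
qed

lemma penalty_slope_inv_has_derivative:
  assumes "\<bar>t\<bar> < L"
  shows "(penalty_slope_inv L \<delta> has_real_derivative \<delta> * L\<^sup>2 / (L\<^sup>2 - t\<^sup>2) powr (3/2)) (at t)"
proof -
  define w where "w = sqrt (L\<^sup>2 - t\<^sup>2)"
  have pos: "L\<^sup>2 - t\<^sup>2 > 0"
    using assms by (simp add: power2_strict_mono abs_less_iff)
  then have w: "w > 0" "w\<^sup>2 = L\<^sup>2 - t\<^sup>2" by (auto simp: w_def)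
  have "((\<lambda>t. \<delta> * t / sqrt (L\<^sup>2 - t\<^sup>2)) has_real_derivative
      (\<delta> * w + \<delta> * t * (t / w)) / (w * w)) (at t)"
    using pos by (auto intro!: derivative_eq_intros simp: w_def field_simps)
  also have "(\<delta> * w + \<delta> * t * (t / w)) / (w * w) = \<delta> * (w\<^sup>2 + t\<^sup>2) / w ^ 3"
    using w(1) by (simp add: field_simps power2_eq_square power3_eq_cube)
  also have "w\<^sup>2 + t\<^sup>2 = L\<^sup>2" using w(2) by simp
  also have "w ^ 3 = (L\<^sup>2 - t\<^sup>2) powr (3/2)"
    using pos by (simp add: w_def powr_half_sqrt[symmetric] powr_powr flip: powr_numeral)
  finally show ?thesis by (simp add: penalty_slope_inv_def[abs_def])
qed

text \<open>
  The derivative of the inverse slope grows with the modulus of its argument, so its value at the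
  endpoint is a Lipschitz constant on a symmetric interval.
\<close>

lemma penalty_slope_inv_lipschitz:
  assumes "\<delta> > 0" "l < L" "\<bar>s\<bar> \<le> l" "\<bar>t\<bar> \<le> l"
  shows "\<bar>penalty_slope_inv L \<delta> s - penalty_slope_inv L \<delta> t\<bar>
    \<le> \<delta> * L\<^sup>2 / (L\<^sup>2 - l\<^sup>2) powr (3/2) * \<bar>s - t\<bar>"
proof -
  have "norm (penalty_slope_inv L \<delta> s - penalty_slope_inv L \<delta> t)
    \<le> \<delta> * L\<^sup>2 / (L\<^sup>2 - l\<^sup>2) powr (3/2) * norm (s - t)"
  proof (rule field_differentiable_bound[where S = "{-l..l}"])
    fix z assume "z \<in> {-l..l}"
    then have z: "\<bar>z\<bar> \<le> l" by auto
    then show "(penalty_slope_inv L \<delta> has_real_derivative \<delta> * L\<^sup>2 / (L\<^sup>2 - z\<^sup>2) powr (3/2))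
        (at z within {-l..l})"
      using assms(2) by (simp add: has_field_derivative_at_within penalty_slope_inv_has_derivative)
    have "z\<^sup>2 \<le> l\<^sup>2" using z by (simp add: abs_le_square_iff[symmetric])
    moreover have "l\<^sup>2 < L\<^sup>2" using assms(2) z by (intro power_strict_mono) auto
    ultimately have "\<delta> * L\<^sup>2 / (L\<^sup>2 - z\<^sup>2) powr (3/2) \<le> \<delta> * L\<^sup>2 / (L\<^sup>2 - l\<^sup>2) powr (3/2)"
      using assms(1) by (intro divide_left_mono powr_mono2 mult_pos_pos) auto
    then show "norm (\<delta> * L\<^sup>2 / (L\<^sup>2 - z\<^sup>2) powr (3/2)) \<le> \<delta> * L\<^sup>2 / (L\<^sup>2 - l\<^sup>2) powr (3/2)"
      using assms(1) by simp
  qed (use assms in auto)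
  then show ?thesis by simp
qed

section \<open>The maximizer and its inverse\<close>

locale penalized_problem =
  fixes f :: "real \<Rightarrow> real" and f' :: "real \<Rightarrow> real" and L l K \<delta> :: real
  assumes f_has_derivative: "(f has_real_derivative f' y) (at y)"
    and slope_le: "\<bar>f' y\<bar> \<le> l"
    and slope_bound_less: "l < L"
    and slope_lipschitz: "K-lipschitz_on UNIV f'"
    and radius_pos: "\<delta> > 0"
    and small_radius: "\<delta> * L\<^sup>2 * K < (L\<^sup>2 - l\<^sup>2) powr (3/2)"
begin

definition foot :: "real \<Rightarrow> real" where
  "foot y = y - penalty_slope_inv L \<delta> (f' y)"

definition contraction_factor :: real where
  "contraction_factor = \<delta> * L\<^sup>2 * K / (L\<^sup>2 - l\<^sup>2) powr (3/2)"

lemma slope_less: "\<bar>f' y\<bar> < L"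
  using slope_le[of y] slope_bound_less by linarith

lemma L_pos: "L > 0"
  using slope_less[of 0] by linarith

lemma slope_eq: "f' y = penalty_slope L \<delta> (y - foot y)"
  by (simp add: foot_def penalty_slope_penalty_slope_inv radius_pos slope_less)

lemma contraction_factor_bounds: "0 \<le> contraction_factor" "contraction_factor < 1"
proof -
  have "l\<^sup>2 < L\<^sup>2"
    using slope_bound_less slope_le[of 0] by (intro power_strict_mono) auto
  then have "(L\<^sup>2 - l\<^sup>2) powr (3/2) > 0" by simp
  then show "contraction_factor < 1" using small_radius by (simp add: contraction_factor_def)
  show "0 \<le> contraction_factor"
    using radius_pos lipschitz_on_nonneg[OF slope_lipschitz] by (simp add: contraction_factor_def)
qed

lemma shift_lipschitz:
  "\<bar>penalty_slope_inv L \<delta> (f' y) - penalty_slope_inv L \<delta> (f' z)\<bar> \<le> contraction_factor * \<bar>y - z\<bar>"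
proof -
  have "\<bar>penalty_slope_inv L \<delta> (f' y) - penalty_slope_inv L \<delta> (f' z)\<bar>
      \<le> \<delta> * L\<^sup>2 / (L\<^sup>2 - l\<^sup>2) powr (3/2) * \<bar>f' y - f' z\<bar>"
    using radius_pos slope_bound_less slope_le by (intro penalty_slope_inv_lipschitz)
  also have "\<dots> \<le> \<delta> * L\<^sup>2 / (L\<^sup>2 - l\<^sup>2) powr (3/2) * (K * \<bar>y - z\<bar>)"
    using lipschitz_onD[OF slope_lipschitz, of y z] radius_pos
    by (intro mult_left_mono) (auto simp: dist_real_def)
  finally show ?thesis by (simp add: contraction_factor_def mult.assoc)
qed

lemma foot_increment_bounds:
  assumes "z \<le> y"
  shows "(1 - contraction_factor) * (y - z) \<le> foot y - foot z"
    and "foot y - foot z \<le> (1 + contraction_factor) * (y - z)"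
proof -
  define d where "d = penalty_slope_inv L \<delta> (f' y) - penalty_slope_inv L \<delta> (f' z)"
  have "\<bar>d\<bar> \<le> contraction_factor * (y - z)"
    using shift_lipschitz[of y z] assms by (simp add: d_def)
  moreover have "foot y - foot z = (y - z) - d" by (simp add: foot_def d_def)
  ultimately show "(1 - contraction_factor) * (y - z) \<le> foot y - foot z"
    and "foot y - foot z \<le> (1 + contraction_factor) * (y - z)"
    unfolding left_diff_distrib distrib_right mult_1 by linarith+
qed

lemma foot_strict_mono: "strict_mono foot"
proof (rule strict_monoI)
  fix z y :: real
  assume "z < y"
  then have "0 < (1 - contraction_factor) * (y - z)" using contraction_factor_bounds by simp
  also have "\<dots> \<le> foot y - foot z" using \<open>z < y\<close> by (intro foot_increment_bounds) simp
  finally show "foot z < foot y" by simp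
qed

lemma foot_dist_le: "\<bar>foot y - foot z\<bar> \<le> (1 + contraction_factor) * \<bar>y - z\<bar>"
proof (cases "z \<le> y")
  case True
  then show ?thesis
    using foot_increment_bounds(2)[of z y] strict_mono_less_eq[OF foot_strict_mono, of z y] by simp
next
  case False
  then show ?thesis
    using foot_increment_bounds(2)[of y z] strict_mono_less_eq[OF foot_strict_mono, of y z] by simp
qed

lemma foot_continuous: "continuous_on UNIV foot"
proof -
  have "(1 + contraction_factor)-lipschitz_on UNIV foot"
    using foot_dist_le contraction_factor_bounds by (intro lipschitz_onI) (auto simp: dist_real_def)
  then show ?thesis by (rule lipschitz_on_continuous_on)
qed

lemma foot_surj: "surj foot"
proof -
  have "\<exists>y. foot y = x" for x
  proof -
    (* An increment of foot is at least 1 - contraction_factor times the step, so steps of this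
       length from 0 in both directions enclose x. *)
    define R where "R = \<bar>x - foot 0\<bar> / (1 - contraction_factor)"
    have R: "R \<ge> 0" "(1 - contraction_factor) * R = \<bar>x - foot 0\<bar>"
      using contraction_factor_bounds by (auto simp: R_def)
    have "foot (-R) \<le> x" "x \<le> foot R"
      using foot_increment_bounds(1)[of 0 R] foot_increment_bounds(1)[of "-R" 0] R by auto
    then show ?thesis
      using IVT'[of foot "-R" x R] R(1) continuous_on_subset[OF foot_continuous] by auto
  qed
  then show ?thesis unfolding surj_def by metis
qed

lemma foot_bij: "bij foot"
  using foot_surj strict_mono_imp_inj_on[OF foot_strict_mono] by (simp add: bij_def)

lemma penalized_has_derivative:
  "(penalized f L \<delta> x has_real_derivative f' y - penalty_slope L \<delta> (y - x)) (at y)"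
proof -
  have "((\<lambda>y. f y - L * sqrt (\<delta>\<^sup>2 + (y - x)\<^sup>2)) has_real_derivative
      f' y - penalty_slope L \<delta> (y - x) * 1) (at y)"
    by (rule DERIV_diff[OF f_has_derivative DERIV_chain2[OF penalty_has_derivative[OF radius_pos]]])
      (auto intro!: derivative_eq_intros)
  then show ?thesis by (simp add: penalized_def[abs_def] power2_commute)
qed

text \<open>
  By \<open>slope_eq\<close> and monotonicity of the penalty slope, the derivative at \<open>z\<close> of the function
  penalized around \<open>x\<close> has the sign of \<open>x - foot z\<close>; for \<open>x = foot y\<close> this is the sign of \<open>y - z\<close>.
\<close>

lemma penalized_less_at_foot:
  assumes "z \<noteq> y"
  shows "penalized f L \<delta> (foot y) z < penalized f L \<delta> (foot y) y"
proof -
  note mono = strict_mono_less[OF penalty_slope_strict_mono[OF radius_pos L_pos]]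
  have sign: "0 < f' w - penalty_slope L \<delta> (w - foot y) \<longleftrightarrow> w < y"
    "f' w - penalty_slope L \<delta> (w - foot y) < 0 \<longleftrightarrow> y < w" for w
    by (auto simp: slope_eq mono strict_mono_less[OF foot_strict_mono])
  have cont: "continuous_on A (penalized f L \<delta> (foot y))" for A
    using penalized_has_derivative
    by (intro continuous_at_imp_continuous_on ballI) (blast intro: DERIV_isCont)
  show ?thesis
  proof (cases "z < y")
    case True
    then show ?thesis
      by (rule DERIV_pos_imp_increasing_open)
        (use penalized_has_derivative sign cont in blast)+
  next
    case False
    with assms have "y < z" by simp
    then show ?thesis
      by (rule DERIV_neg_imp_decreasing_open)
        (use penalized_has_derivative sign cont in blast)+
  qed
qed

lemma penalized_le_at_foot: "penalized f L \<delta> (foot y) z \<le> penalized f L \<delta> (foot y) y"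
  using penalized_less_at_foot[of z y] by (cases "z = y") auto

lemma upper_envelope_foot: "upper_envelope f L \<delta> (foot y) = penalized f L \<delta> (foot y) y"
  unfolding upper_envelope_def by (rule cSup_eq_maximum) (auto simp: penalized_le_at_foot)

lemma penalized_le_upper_envelope: "penalized f L \<delta> x y \<le> upper_envelope f L \<delta> x"
proof -
  obtain z where "x = foot z" using foot_surj by blast
  then show ?thesis by (simp add: upper_envelope_foot penalized_le_at_foot)
qed

lemma maximizer_foot: "maximizer f L \<delta> (foot y) = y"
  unfolding maximizer_def upper_envelope_foot
  by (rule the_equality) (use penalized_less_at_foot in force)+

lemma inv_maximizer: "inv (maximizer f L \<delta>) = foot"
proof -
  have "maximizer f L \<delta> = inv foot"
  proof
    show "maximizer f L \<delta> x = inv foot x" for x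
      using maximizer_foot[of "inv foot x"] by (simp add: surj_f_inv_f foot_surj)
  qed
  then show ?thesis using foot_bij by (simp add: inv_inv_eq)
qed

section \<open>Differentiability of the envelope\<close>

text \<open>
  The envelope minus the function \<open>x \<mapsto> penalized f L \<delta> x y\<close> attains its minimum \<open>0\<close> at \<open>foot y\<close>,
  so the two derivatives agree there.
\<close>

lemma upper_envelope_derivative:
  assumes "(upper_envelope f L \<delta> has_real_derivative d) (at (foot y))"
  shows "d = f' y"
proof -
  have "((\<lambda>x. f y - L * sqrt (\<delta>\<^sup>2 + (y - x)\<^sup>2)) has_real_derivative
      0 - penalty_slope L \<delta> (y - foot y) * (-1)) (at (foot y))"
    by (rule DERIV_diff[OF DERIV_const DERIV_chain2[OF penalty_has_derivative[OF radius_pos]]])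
      (auto intro!: derivative_eq_intros)
  then have "((\<lambda>x. penalized f L \<delta> x y) has_real_derivative f' y) (at (foot y))"
    by (simp add: penalized_def power2_commute slope_eq[symmetric])
  with assms have "((\<lambda>x. upper_envelope f L \<delta> x - penalized f L \<delta> x y)
      has_real_derivative d - f' y) (at (foot y))"
    by (rule DERIV_diff)
  then have "d - f' y = 0"
    by (rule DERIV_local_min[where d = 1])
      (simp_all add: upper_envelope_foot penalized_le_upper_envelope)
  then show ?thesis by simp
qed

text \<open>
  A derivative of the inverse of \<open>foot\<close> cannot vanish, since all its difference quotients are
  bounded below by the reciprocal of the Lipschitz constant of \<open>foot\<close>.
\<close>

lemma inv_foot_derivative_nonzero:
  assumes "(inv foot has_real_derivative e) (at x)"
  shows "e \<noteq> 0"
proof -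
  have "1 / (1 + contraction_factor) \<le> \<bar>(inv foot z - inv foot x) / (z - x)\<bar>" if "z \<noteq> x" for z
    using foot_dist_le[of "inv foot z" "inv foot x"] contraction_factor_bounds that
    by (simp add: surj_f_inv_f[OF foot_surj] field_simps)
  then have "eventually (\<lambda>z. 1 / (1 + contraction_factor) \<le> \<bar>(inv foot z - inv foot x) / (z - x)\<bar>) (at x)"
    by (auto simp: eventually_at_filter)
  moreover have "((\<lambda>z. \<bar>(inv foot z - inv foot x) / (z - x)\<bar>) \<longlongrightarrow> \<bar>e\<bar>) (at x)"
    using assms by (intro tendsto_rabs) (simp add: has_field_derivative_iff)
  ultimately have "1 / (1 + contraction_factor) \<le> \<bar>e\<bar>"
    by (intro tendsto_lowerbound) auto
  moreover have "0 < 1 / (1 + contraction_factor)" using contraction_factor_bounds by simp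
  ultimately show ?thesis by auto
qed

lemma slope_differentiable_if_upper_envelope_twice_differentiable:
  assumes "twice_differentiable_at (upper_envelope f L \<delta>) (foot y)"
  shows "f' differentiable (at y)"
proof -
  let ?u' = "deriv (upper_envelope f L \<delta>)"
  have ev: "\<forall>\<^sub>F z in nhds (foot y). upper_envelope f L \<delta> differentiable (at z)"
    and "?u' differentiable (at (foot y))"
    using assms by (auto simp: twice_differentiable_at_def)
  then obtain d where d: "(?u' has_real_derivative d) (at (foot y))"
    by (auto simp: real_differentiable_def)
  have envelope_slope: "?u' z = f' (inv foot z)"
    if "upper_envelope f L \<delta> differentiable (at z)" for z
    using that upper_envelope_derivative[of _ "inv foot z"]
    by (metis DERIV_imp_deriv foot_surj real_differentiable_def surj_f_inv_f)
  have near: "\<forall>\<^sub>F z in nhds (foot y). inv foot z = z + penalty_slope_inv L \<delta> (?u' z)"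
    using ev
  proof eventually_elim
    case (elim z)
    then show ?case
      using surj_f_inv_f[OF foot_surj, of z] by (simp add: envelope_slope foot_def)
  qed
  have "?u' (foot y) = f' y"
    using eventually_nhds_x_imp_x[OF ev] foot_bij by (simp add: envelope_slope bij_is_inj)
  then have "\<bar>?u' (foot y)\<bar> < L" by (simp add: slope_less)
  note G_deriv = penalty_slope_inv_has_derivative[OF this, of \<delta>]
  obtain e where "((\<lambda>z. z + penalty_slope_inv L \<delta> (?u' z)) has_real_derivative e) (at (foot y))"
    using DERIV_add[OF DERIV_ident DERIV_chain2[OF G_deriv d]] by blast
  then have e: "(inv foot has_real_derivative e) (at (foot y))"
    using DERIV_cong_ev[OF refl near refl] by simp
  have "(foot has_real_derivative inverse e) (at y)"
  proof (rule has_field_derivative_inverse_basic[where f = "inv foot" and t = UNIV])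
    show "(inv foot has_real_derivative e) (at (foot y))" by (rule e)
    show "e \<noteq> 0" using e by (rule inv_foot_derivative_nonzero)
    show "continuous (at y) foot"
      using foot_continuous by (simp add: continuous_on_eq_continuous_at)
    show "inv foot (foot z) = z" for z
      using foot_bij by (simp add: bij_is_inj)
  qed auto
  then have "((\<lambda>z. penalty_slope L \<delta> (z - foot z)) has_real_derivative
      L * \<delta>\<^sup>2 / sqrt (\<delta>\<^sup>2 + (y - foot y)\<^sup>2) ^ 3 * (1 - inverse e)) (at y)"
    by (rule DERIV_chain2[OF penalty_slope_has_derivative[OF radius_pos]
          DERIV_diff[OF DERIV_ident]])
  then show ?thesis
    by (auto simp: slope_eq[symmetric] real_differentiable_def)
qed

end

section \<open>Optimal constants of the derivative\<close>

lemma abs_le_sup_norm: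
  assumes "bounded (range g)"
  shows "\<bar>g x\<bar> \<le> sup_norm g"
proof -
  have "bdd_above (range (\<lambda>x. \<bar>g x\<bar>))"
    using assms by (auto simp: bounded_iff bdd_above_def)
  then show ?thesis unfolding sup_norm_def by (intro cSUP_upper) auto
qed

lemma lipschitz_on_lipschitz_constant:
  assumes "C-lipschitz_on UNIV g"
  shows "(lipschitz_constant g)-lipschitz_on UNIV g"
proof (rule lipschitz_onI)
  let ?S = "{C. C-lipschitz_on UNIV g}"
  have ne: "?S \<noteq> {}" using assms by auto
  show "0 \<le> lipschitz_constant g"
    unfolding lipschitz_constant_def using ne by (intro cInf_greatest) (auto dest: lipschitz_on_nonneg)
  show "dist (g x) (g y) \<le> lipschitz_constant g * dist x y" for x y
  proof (cases "x = y")
    case False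
    have "dist (g x) (g y) / dist x y \<le> lipschitz_constant g"
      unfolding lipschitz_constant_def using ne
    proof (rule cInf_greatest)
      fix B assume "B \<in> ?S"
      then show "dist (g x) (g y) / dist x y \<le> B"
        using False lipschitz_onD[of B UNIV g x y] by (simp add: divide_le_eq)
    qed
    then show ?thesis using False by (simp add: divide_le_eq)
  qed simp
qed

section \<open>Loss of second differentiability\<close>

theorem lemma5:
  fixes f :: "real \<Rightarrow> real" and L Lf Lf' D \<delta> y0 :: real
  assumes "C11 f"
    and "Lf = sup_norm (deriv f)"
    and "Lf' = lipschitz_constant (deriv f)"
    and "L > Lf"
    and "D = 2 * L * Lf / (L\<^sup>2 - Lf\<^sup>2)"
    and "\<delta> > 0"
    and "\<delta> * Lf' * (1 + D\<^sup>2) powr (3/2) < L"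
    and "\<delta> * L\<^sup>2 * Lf' < (L\<^sup>2 - Lf\<^sup>2) powr (3/2)"
    and "\<not> twice_differentiable_at f y0"
  shows "\<not> twice_differentiable_at (upper_envelope f L \<delta>) (inv (maximizer f L \<delta>) y0)"
proof -
  have diff: "f differentiable (at y)" for y using assms(1) by (simp add: C11_def)
  obtain C where C: "C-lipschitz_on UNIV (deriv f)" using assms(1) by (auto simp: C11_def)
  interpret penalized_problem f "deriv f" L Lf Lf' \<delta>
  proof
    show "(f has_real_derivative deriv f y) (at y)" for y
      using diff by (metis DERIV_imp_deriv real_differentiable_def)
    show "\<bar>deriv f y\<bar> \<le> Lf" for y
      using assms(1,2) by (simp add: C11_def abs_le_sup_norm)
    show "Lf'-lipschitz_on UNIV (deriv f)"
      using C assms(3) by (simp add: lipschitz_on_lipschitz_constant)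
  qed (use assms in auto)
  have "\<not> deriv f differentiable (at y0)"
    using assms(9) diff by (simp add: twice_differentiable_at_def)
  then show ?thesis
    using slope_differentiable_if_upper_envelope_twice_differentiable by (auto simp: inv_maximizer)
qed

end
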